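(* Let $H\in\mathbb{R}^{n\times n}$ be a symmetric matrix and let $1\le d\le n$. Let $\mu_1\ge\mu_2\ge\cdots\ge\mu_n$ be the eigenvalues of $H$ sorted in decreasing order (with sign, counted with multiplicity), with corresponding orthonormal eigenvectors $h_1,\dots,h_n$. Then the matrix $A^\ast\in\mathbb{R}^{n\times d}$ whose columns are $h_1,\dots,h_d$ is a solution to the problem $$\max_{A\in\mathbb{R}^{n\times d},\ A^\top A=I_d}\ \mathrm{tr}\big(A^\top H A\big).$$
   Context: $I_d$ is the $d\times d$ identity matrix and $\mathrm{tr}$ denotes the trace. $H$ is not assumed to be positive semidefinite. *)

theory Defs
  imports "Jordan_Normal_Form.Char_Poly"
begin

definition trace_mat :: "'a :: comm_monoid_add mat \<Rightarrow> 'a" where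
  "trace_mat A = (\<Sum>i<dim_row A. A $$ (i, i))"

end

theory Submission
  imports Defs
begin

text \<open>
  In the orthonormal eigenbasis the objective becomes \<open>\<Sum>i. \<mu> i * r i\<close>, where \<open>r i\<close> is the squared
  norm of the \<open>i\<close>-th row of a matrix \<open>B\<close> with orthonormal columns. These weights lie in \<open>[0, 1]\<close> and
  sum to \<open>d\<close>, so the weighted sum is largest when the \<open>d\<close> largest eigenvalues get all the weight.
\<close>

text \<open>An exchange argument with the threshold \<open>?c\<close>, the smallest of the first
  \<open>d\<close> values. Below \<open>d\<close> one has \<open>\<nu> i\<close> \<ge>
  \<open>?c\<close> and \<open>r i\<close> \<le> 1, from \<open>d\<close> on \<open>\<nu> i\<close>
  \<le> \<open>?c\<close> and \<open>r i\<close> \<ge> 0, so each product of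
  \<open>\<nu> i - ?c\<close> with the excess of \<open>r\<close> over the 0/1 weight
  \<open>?e\<close> is nonpositive.\<close>

lemma sum_weighted_le_sum_initial:
  fixes \<nu> r :: "nat \<Rightarrow> real"
  assumes mono: "antimono_on {..<n} \<nu>"
    and d: "0 < d" "d \<le> n"
    and nonneg: "\<And>i. i < n \<Longrightarrow> 0 \<le> r i"
    and le_1: "\<And>i. i < n \<Longrightarrow> r i \<le> 1"
    and total: "(\<Sum>i<n. r i) = real d"
  shows "(\<Sum>i<n. \<nu> i * r i) \<le> (\<Sum>i<d. \<nu> i)"
proof -
  let ?c = "\<nu> (d - 1)"
  let ?e = "\<lambda>i. if i < d then 1 else 0 :: real"
  have restrict: "(\<Sum>i<n. f i * ?e i) = (\<Sum>i<d. f i)" for f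
  proof -
    have "(\<Sum>i<n. f i * ?e i) = (\<Sum>i<n. if i \<in> {..<d} then f i else 0)"
      by (rule sum.cong) auto
    also have "\<dots> = sum f ({..<n} \<inter> {..<d})"
      by (simp add: sum.inter_restrict)
    also have "{..<n} \<inter> {..<d} = {..<d}"
      using d by auto
    finally show ?thesis .
  qed
  have "(\<nu> i - ?c) * (r i - ?e i) \<le> 0" if "i < n" for i
  proof (cases "i < d")
    case True
    then have "?c \<le> \<nu> i"
      using monotone_onD[OF mono, of i "d - 1"] d by auto
    then show ?thesis
      using le_1[OF that] True by (simp add: mult_nonneg_nonpos)
  next
    case False
    then have "\<nu> i \<le> ?c"
      using monotone_onD[OF mono, of "d - 1" i] d that by auto
    then show ?thesis
      using nonneg[OF that] False by (simp add: mult_nonpos_nonneg)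
  qed
  then have "(\<Sum>i<n. (\<nu> i - ?c) * (r i - ?e i)) \<le> 0"
    by (intro sum_nonpos) auto
  \<comment> \<open>The weights \<open>r\<close> and \<open>?e\<close> both have total
    \<open>d\<close>, so the two terms with \<open>?c\<close> cancel. The factor 1 in the last sum
    gives it the shape that \<open>restrict\<close> expects.\<close>
  moreover have "(\<Sum>i<n. (\<nu> i - ?c) * (r i - ?e i))
      = (\<Sum>i<n. \<nu> i * r i) - ?c * (\<Sum>i<n. r i)
        - (\<Sum>i<n. \<nu> i * ?e i) + ?c * (\<Sum>i<n. 1 * ?e i)"
    unfolding sum_distrib_left sum_subtractf[symmetric] sum.distrib[symmetric]
    by (rule sum.cong) (auto simp: algebra_simps)
  ultimately show ?thesis
    unfolding restrict total by simp
qed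

text \<open>The squared row norms are the diagonal entries of the orthogonal projection
  \<open>P\<close> onto the column space of \<open>B\<close>. Symmetry and idempotence make such an
  entry \<open>p\<close> the sum of the squares of its row of \<open>P\<close>, hence at least the
  square of \<open>p\<close> itself.\<close>

lemma row_norm_le_1_of_orthonormal_cols:
  fixes B :: "real mat"
  assumes B: "B \<in> carrier_mat n d"
    and orth: "transpose_mat B * B = 1\<^sub>m d"
    and i: "i < n"
  shows "row B i \<bullet> row B i \<le> 1"
proof -
  define P where "P = B * transpose_mat B"
  have P: "P \<in> carrier_mat n n"
    using B by (simp add: P_def)
  have Bt: "transpose_mat B \<in> carrier_mat d n"
    using B by simp
  have "transpose_mat B * P = transpose_mat B"
    unfolding P_def assoc_mult_mat[OF Bt B Bt, symmetric] orth using Bt by simp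
  then have idem: "P * P = P"
    using assoc_mult_mat[OF B Bt P] by (simp add: P_def)
  have P_entry: "P $$ (j, k) = row B j \<bullet> row B k" if "j < n" "k < n" for j k
    using B that by (simp add: P_def)
  have sym: "P $$ (j, k) = P $$ (k, j)" if "j < n" "k < n" for j k
    using B that by (simp add: P_entry comm_scalar_prod[of _ d])
  let ?p = "P $$ (i, i)"
  have "?p = (P * P) $$ (i, i)"
    by (simp add: idem)
  also have "\<dots> = (\<Sum>k<n. P $$ (i, k) * P $$ (k, i))"
    using P i by (simp add: scalar_prod_def atLeast0LessThan)
  also have "\<dots> = (\<Sum>k<n. (P $$ (i, k))\<^sup>2)"
    using i by (intro sum.cong) (auto simp: sym[of _ i] power2_eq_square)
  finally have "?p\<^sup>2 \<le> ?p"
    using member_le_sum[of i "{..<n}" "\<lambda>k. (P $$ (i, k))\<^sup>2"] i by simp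
  \<comment> \<open>If \<open>?p\<close> exceeded 1, its square would be strictly larger than
    \<open>?p\<close>.\<close>
  then have "?p \<le> 1"
    using power_strict_increasing[of 1 2 ?p] by fastforce
  then show ?thesis
    using P_entry[OF i i] by simp
qed

text \<open>Summing the squares of \<open>B\<close> by rows instead of by columns turns the trace
  into a weighted sum of the values \<open>\<nu> i\<close>.\<close>

lemma trace_conj_mat_diag:
  fixes B :: "real mat"
  assumes B: "B \<in> carrier_mat n d"
  shows "trace_mat (transpose_mat B * mat_diag n \<nu> * B) = (\<Sum>i<n. \<nu> i * (row B i \<bullet> row B i))"
proof -
  have "trace_mat (transpose_mat B * mat_diag n \<nu> * B) = (\<Sum>j<d. \<Sum>i<n. \<nu> i * (B $$ (i, j))\<^sup>2)"
    unfolding trace_mat_def using B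
    by (auto intro!: sum.cong simp: mat_diag_mult_right[of _ d] scalar_prod_def
        atLeast0LessThan power2_eq_square)
  also have "\<dots> = (\<Sum>i<n. \<Sum>j<d. \<nu> i * (B $$ (i, j))\<^sup>2)"
    by (rule sum.swap)
  also have "\<dots> = (\<Sum>i<n. \<nu> i * (row B i \<bullet> row B i))"
    using B by (auto intro!: sum.cong
        simp: scalar_prod_def atLeast0LessThan power2_eq_square sum_distrib_left)
  finally show ?thesis .
qed

lemma trace_conj_mat_diag_le:
  fixes B :: "real mat"
  assumes B: "B \<in> carrier_mat n d"
    and orth: "transpose_mat B * B = 1\<^sub>m d"
    and d: "0 < d" "d \<le> n"
    and mono: "antimono_on {..<n} \<nu>"
  shows "trace_mat (transpose_mat B * mat_diag n \<nu> * B) \<le> (\<Sum>i<d. \<nu> i)"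
  unfolding trace_conj_mat_diag[OF B]
proof (rule sum_weighted_le_sum_initial[OF mono d])
  show "0 \<le> row B i \<bullet> row B i" for i
    by (auto simp: scalar_prod_def intro!: sum_nonneg)
  show "row B i \<bullet> row B i \<le> 1" if "i < n" for i
    by (rule row_norm_le_1_of_orthonormal_cols[OF B orth that])
  \<comment> \<open>With all diagonal values equal to 1 the trace identity computes the total weight
    as the trace of the Gram matrix of \<open>B\<close>, which is \<open>d\<close>.\<close>
  have "mat_diag n (\<lambda>_. 1 :: real) = 1\<^sub>m n"
    by (simp add: mat_diag_one)
  then show "(\<Sum>i<n. row B i \<bullet> row B i) = real d"
    using trace_conj_mat_diag[OF B, of "\<lambda>_. 1"] B
    by (simp add: orth trace_mat_def)
qed

text \<open>The count \<open>m\<close> is kept free: \<open>m = d\<close> yields feasibility of the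
  maximiser, \<open>m = n\<close> the orthogonality of the full eigenvector matrix.\<close>

lemma gram_mat_of_cols_orthonormal:
  fixes h :: "nat \<Rightarrow> 'a :: comm_ring_1 vec"
  assumes h: "\<And>i. i \<in> {1..m} \<Longrightarrow> h i \<in> carrier_vec n"
    and orthonormal: "\<And>i j. i \<in> {1..m} \<Longrightarrow> j \<in> {1..m} \<Longrightarrow> h i \<bullet> h j = (if i = j then 1 else 0)"
  defines "Q \<equiv> mat_of_cols n (map h [1..<Suc m])"
  shows "transpose_mat Q * Q = 1\<^sub>m m"
proof (rule eq_matI)
  \<comment> \<open>Matrix columns are counted from 0, the eigenvectors from 1.\<close>
  have col: "col Q j = h (Suc j)" if "j < m" for j
    using that h[of "Suc j"] by (simp add: Q_def del: upt_Suc)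
  have "dim_col Q = m"
    by (simp add: Q_def)
  then show "(transpose_mat Q * Q) $$ (i, j) = 1\<^sub>m m $$ (i, j)"
    if "i < dim_row (1\<^sub>m m)" "j < dim_col (1\<^sub>m m)" for i j
    using that by (simp add: col orthonormal)
qed (simp_all add: Q_def)

text \<open>Column \<open>j\<close> of \<open>H * Q\<close> is an eigenvalue times column
  \<open>j\<close> of \<open>Q\<close>, so orthonormality leaves only the diagonal. The case
  \<open>m = d\<close> gives the value attained, \<open>m = n\<close> the diagonalisation of
  \<open>H\<close>.\<close>

lemma conj_mat_of_cols_eigenvectors:
  fixes h :: "nat \<Rightarrow> 'a :: comm_ring_1 vec"
  assumes H: "H \<in> carrier_mat n n"
    and eigenvectors: "\<And>i. i \<in> {1..m} \<Longrightarrow> eigenvector H (h i) (\<mu> i)"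
    and orthonormal: "\<And>i j. i \<in> {1..m} \<Longrightarrow> j \<in> {1..m} \<Longrightarrow> h i \<bullet> h j = (if i = j then 1 else 0)"
  defines "Q \<equiv> mat_of_cols n (map h [1..<Suc m])"
  shows "transpose_mat Q * H * Q = mat_diag m (\<lambda>i. \<mu> (Suc i))"
proof -
  have h: "h i \<in> carrier_vec n" "H *\<^sub>v h i = \<mu> i \<cdot>\<^sub>v h i" if "i \<in> {1..m}" for i
    using eigenvectors[OF that] H by (auto simp: eigenvector_def)
  have Q: "Q \<in> carrier_mat n m"
    using mat_of_cols_carrier(1)[of n "map h [1..<Suc m]"] by (simp add: Q_def del: upt_Suc)
  have col: "col Q j = h (Suc j)" if "j < m" for j
    using that h(1)[of "Suc j"] by (simp add: Q_def del: upt_Suc)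
  have "transpose_mat Q * (H * Q) = mat_diag m (\<lambda>i. \<mu> (Suc i))"
  proof (rule eq_matI)
    fix i j
    assume "i < dim_row (mat_diag m (\<lambda>i. \<mu> (Suc i)))" "j < dim_col (mat_diag m (\<lambda>i. \<mu> (Suc i)))"
    then have ij: "i < m" "j < m"
      by (auto simp: mat_diag_def)
    have "col (H * Q) j = \<mu> (Suc j) \<cdot>\<^sub>v h (Suc j)"
      using ij h(2)[of "Suc j"] by (simp only: col_mult2[OF H Q] col) simp
    then have "(transpose_mat Q * (H * Q)) $$ (i, j) = h (Suc i) \<bullet> (\<mu> (Suc j) \<cdot>\<^sub>v h (Suc j))"
      using ij Q H by (simp add: col del: col_mult)
    also have "\<dots> = \<mu> (Suc j) * (h (Suc i) \<bullet> h (Suc j))"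
      using ij h(1)[of "Suc i"] h(1)[of "Suc j"] by (simp add: scalar_prod_smult_distrib[of _ n])
    finally show "(transpose_mat Q * (H * Q)) $$ (i, j) = mat_diag m (\<lambda>i. \<mu> (Suc i)) $$ (i, j)"
      using ij by (simp add: orthonormal mat_diag_def)
  qed (use Q H in \<open>auto simp: mat_diag_def\<close>)
  then show ?thesis
    using Q H by (simp add: assoc_mult_mat[of _ m n _ n _ m])
qed

theorem lemma9:
  fixes H :: "real mat" and n d :: nat
    and \<mu> :: "nat \<Rightarrow> real" and h :: "nat \<Rightarrow> real vec"
  assumes H: "H \<in> carrier_mat n n"
    and symmetric: "transpose_mat H = H"
    and d: "1 \<le> d" "d \<le> n"
    and eigenvalues: "char_poly H = (\<Prod>i\<in>{1..n}. [:- \<mu> i, 1:])"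
    and decreasing: "antimono_on {1..n} \<mu>"
    and eigenvectors: "\<And>i. i \<in> {1..n} \<Longrightarrow> eigenvector H (h i) (\<mu> i)"
    and orthonormal: "\<And>i j. i \<in> {1..n} \<Longrightarrow> j \<in> {1..n} \<Longrightarrow>
          h i \<bullet> h j = (if i = j then 1 else 0)"
  shows "is_arg_max (\<lambda>A. trace_mat (transpose_mat A * H * A))
           (\<lambda>A. A \<in> carrier_mat n d \<and> transpose_mat A * A = 1\<^sub>m d)
           (mat_of_cols n (map h [1..<Suc d]))"
proof -
  define cols where "cols m = mat_of_cols n (map h [1..<Suc m])" for m
  have h: "h i \<in> carrier_vec n" if "i \<in> {1..n}" for i
    using eigenvectors[OF that] H by (auto simp: eigenvector_def)
  have cols: "cols m \<in> carrier_mat n m" for m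
    using mat_of_cols_carrier(1)[of n "map h [1..<Suc m]"] by (simp add: cols_def del: upt_Suc)
  have gram: "transpose_mat (cols m) * cols m = 1\<^sub>m m" if "m \<le> n" for m
    unfolding cols_def using that by (intro gram_mat_of_cols_orthonormal) (auto simp: h orthonormal)
  have diag: "transpose_mat (cols m) * H * cols m = mat_diag m (\<lambda>i. \<mu> (Suc i))" if "m \<le> n" for m
    unfolding cols_def using that H
    by (intro conj_mat_of_cols_eigenvectors) (auto simp: eigenvectors orthonormal)
  have attained: "trace_mat (transpose_mat (cols d) * H * cols d) = (\<Sum>i<d. \<mu> (Suc i))"
    unfolding diag[OF d(2)] by (simp add: trace_mat_def mat_diag_def)
  have bound: "trace_mat (transpose_mat A * H * A) \<le> (\<Sum>i<d. \<mu> (Suc i))"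
    if A: "A \<in> carrier_mat n d" and orth: "transpose_mat A * A = 1\<^sub>m d" for A
  proof -
    define Q where "Q = cols n"
    \<comment> \<open>The columns of \<open>B\<close> are the coordinates of those of
      \<open>A\<close> in the eigenbasis.\<close>
    define B where "B = transpose_mat Q * A"
    have Q: "Q \<in> carrier_mat n n"
      using cols by (simp add: Q_def)
    then have Qt: "transpose_mat Q \<in> carrier_mat n n"
      by simp
    have B: "B \<in> carrier_mat n d"
      using Q A by (simp add: B_def)
    \<comment> \<open>\<open>Q\<close> is square, so its left inverse is also a right inverse; this
      recovers \<open>A\<close> from \<open>B\<close>.\<close>
    have "Q * transpose_mat Q = 1\<^sub>m n"
      using mat_mult_left_right_inverse[OF Qt Q] gram[of n] by (simp add: Q_def)
    then have A_eq: "A = Q * B"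
      using assoc_mult_mat[OF Q Qt A] A by (simp add: B_def)
    have At: "transpose_mat A = transpose_mat B * transpose_mat Q"
      unfolding A_eq using Q B by (rule transpose_mult)
    have Bt: "transpose_mat B \<in> carrier_mat d n"
      using B by simp
    have "transpose_mat B * B = transpose_mat A * A"
      using assoc_mult_mat[OF Bt Qt A] by (simp add: At B_def)
    then have orthB: "transpose_mat B * B = 1\<^sub>m d"
      by (simp add: orth)
    \<comment> \<open>Regrouping isolates the diagonalised \<open>H\<close> between \<open>B\<close>
      and its transpose, which is the diagonal case already bounded.\<close>
    have "transpose_mat A * H * A = transpose_mat B * transpose_mat Q * H * (Q * B)"
      by (simp only: At flip: A_eq)
    also have "\<dots> = transpose_mat B * (transpose_mat Q * H * Q) * B"
      using assoc_mult_mat[OF Bt Qt H] assoc_mult_mat[OF Bt mult_carrier_mat[OF Qt H] Q]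
        assoc_mult_mat[OF mult_carrier_mat[OF Bt mult_carrier_mat[OF Qt H]] Q B]
      by simp
    also have "transpose_mat Q * H * Q = mat_diag n (\<lambda>i. \<mu> (Suc i))"
      by (simp add: diag Q_def)
    finally have "transpose_mat A * H * A = transpose_mat B * mat_diag n (\<lambda>i. \<mu> (Suc i)) * B" .
    moreover have "antimono_on {..<n} (\<lambda>i. \<mu> (Suc i))"
      using decreasing by (auto simp: monotone_on_def)
    ultimately show ?thesis
      using trace_conj_mat_diag_le[OF B orthB _ d(2)] d(1) by simp
  qed
  \<comment> \<open>\<open>is_arg_max\<close> asks for feasibility and that no feasible matrix has a
    strictly larger value; the latter is \<open>bound\<close> compared with
    \<open>attained\<close>.\<close>
  show ?thesis
    unfolding is_arg_max_def cols_def[symmetric]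
    using cols[of d] gram[OF d(2)] bound attained by (auto simp: not_less)
qed

end
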